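(* Let $n\geq 1$ be an integer. For every integer $k$, the number of even binary words of length $2n$ whose number of inversions is congruent to $k$ modulo $2n-1$ is independent of $k$, and is equal to $\frac{1}{2n-1}\binom{2n}{n}$.
   Context: A binary word is a finite sequence of 0's and 1's. An even binary word of length $2n$ is a binary word $b=b_1b_2\cdots b_{2n}$ in which exactly $n$ of the digits are 0 (and hence exactly $n$ are 1). An inversion in $b$ is a (not necessarily adjacent) subsequence of the form "1 0", i.e. a pair of indices $i<j$ with $b_i=1$ and $b_j=0$; the number of inversions is the number of such pairs. *)

theory Defs
  imports Complex_Main "HOL-Number_Theory.Cong"
begin

definition binary_word :: "nat list \<Rightarrow> bool" where
  "binary_word b \<longleftrightarrow> set b \<subseteq> {0, 1}"

definition even_binary_words :: "nat \<Rightarrow> nat list set" where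
  "even_binary_words n = {b. binary_word b \<and> length b = 2 * n \<and> count_list b 0 = n}"

(* Positions are counted from 0 here, which does not affect the number of pairs. *)
definition inversions :: "nat list \<Rightarrow> (nat \<times> nat) set" where
  "inversions b = {(i, j). i < j \<and> j < length b \<and> b ! i = 1 \<and> b ! j = 0}"

definition num_inversions :: "nat list \<Rightarrow> nat" where
  "num_inversions b = card (inversions b)"

definition even_words_inv_cong :: "nat \<Rightarrow> int \<Rightarrow> nat list set" where
  "even_words_inv_cong n k =
     {b \<in> even_binary_words n. [int (num_inversions b) = k] (mod (2 * int n - 1))}"

end

theory Submission
  imports Defs
begin

text \<open>
  Write an even word as \<open>x # w\<close> and rotate only the tail \<open>w\<close>, which has odd length
  \<open>2n - 1\<close>. If \<open>w\<close> has \<open>p\<close> zeros and \<open>q\<close> ones, then moving its first letter to the end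
  creates \<open>q\<close> inversions when that letter is 0 and destroys \<open>p\<close> of them when it is 1; modulo
  \<open>p + q\<close> both amount to adding \<open>q\<close> (lemma \<open>num_inversions_rotate1\<close>). So rotation maps the words with
  residue \<open>k\<close> bijectively onto those with residue \<open>k + q\<close>. When \<open>p\<close> and \<open>q\<close> are coprime,
  \<open>q\<close> generates the residues modulo \<open>p + q\<close>, and therefore the inversion number is
  equidistributed on the words with \<open>p\<close> zeros and \<open>q\<close> ones (lemma \<open>inversions_equidistributed\<close>).

  The tails of even words have \<open>(p, q) = (n - 1, n)\<close> or \<open>(n, n - 1)\<close>, which are coprime pairs
  with sum \<open>2n - 1\<close>. The letter \<open>x\<close> adds the same number of inversions to every tail of its
  kind, so it only shifts the residues, and the two equidistributions add up:
  \<open>C(2n-1, n-1) + C(2n-1, n) = C(2n, n)\<close>.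
\<close>

section \<open>Inversions under concatenation and rotation\<close>

lemma finite_inversions: "finite (inversions b)"
  by (rule finite_subset[of _ "{..<length b} \<times> {..<length b}"]) (auto simp: inversions_def)

lemma num_inversions_Cons:
  "num_inversions (x # w) = (if x = 1 then count_list w 0 else 0) + num_inversions w"
proof -
  let ?new = "if x = 1 then (\<lambda>j. (0 :: nat, Suc j)) ` {j. j < length w \<and> w ! j = 0} else {}"
  let ?old = "map_prod Suc Suc ` inversions w"
  have split: "inversions (x # w) = ?new \<union> ?old"
  proof (intro set_eqI)
    fix ij :: "nat \<times> nat"
    obtain i j where ij: "ij = (i, j)" by (cases ij)
    show "ij \<in> inversions (x # w) \<longleftrightarrow> ij \<in> ?new \<union> ?old"
      by (cases i; cases j) (auto simp: ij inversions_def image_iff)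
  qed
  have count: "count_list w 0 = card {j. j < length w \<and> w ! j = 0}"
    by (simp add: count_list_eq_length_filter length_filter_conv_card eq_commute[of "0::nat"])
  have "card (inversions (x # w)) = card ?new + card ?old"
    unfolding split
    by (rule card_Un_disjoint) (auto simp: finite_inversions)
  moreover have "card ?old = card (inversions w)"
    by (rule card_image) (auto simp: inj_on_def)
  moreover have "card ?new = (if x = 1 then count_list w 0 else 0)"
    unfolding count by (auto simp: card_image inj_on_def)
  ultimately show ?thesis
    by (simp add: num_inversions_def)
qed

lemma num_inversions_Nil [simp]: "num_inversions [] = 0"
  by (simp add: num_inversions_def inversions_def)

lemma num_inversions_append:
  "num_inversions (u @ v) = num_inversions u + num_inversions v + count_list u 1 * count_list v 0"
  by (induction u) (auto simp: num_inversions_Cons)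

definition words_with_counts :: "nat \<Rightarrow> nat \<Rightarrow> nat list set" where
  "words_with_counts p q = {w. binary_word w \<and> count_list w 0 = p \<and> count_list w 1 = q}"

lemma rotate1_in_words_with_counts_iff:
  "rotate1 w \<in> words_with_counts p q \<longleftrightarrow> w \<in> words_with_counts p q"
  by (cases w) (auto simp: words_with_counts_def binary_word_def)

text \<open>
  A leading 0 stands before \<open>q\<close> ones, which it follows after the rotation; a leading 1 stands
  before \<open>p\<close> zeros and loses its inversions with them. The changes \<open>q\<close> and \<open>- p\<close> agree modulo
  \<open>p + q\<close>, so the residue moves by an amount that does not depend on the word.
\<close>

lemma num_inversions_rotate1:
  assumes "w \<in> words_with_counts p q"
  shows "[int (num_inversions (rotate1 w)) = int (num_inversions w) + int q] (mod (int p + int q))"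
proof (cases w)
  case Nil
  with assms show ?thesis by (simp add: words_with_counts_def)
next
  case (Cons y v)
  with assms consider "y = 0" "count_list v 1 = q" | "y = 1" "count_list v 0 = p"
    by (auto simp: words_with_counts_def binary_word_def)
  then show ?thesis
  proof cases
    case 1
    then show ?thesis
      by (simp add: Cons num_inversions_append num_inversions_Cons)
  next
    case 2
    then have "int (num_inversions w) + int q
        = int (num_inversions (rotate1 w)) + (int p + int q)"
      by (simp add: Cons num_inversions_append num_inversions_Cons)
    then show ?thesis by (simp only: cong_def mod_add_self2)
  qed
qed

section \<open>Counting binary words by their first letter\<close>

lemma binary_word_Cons: "binary_word (x # w) \<longleftrightarrow> (x = 0 \<or> x = 1) \<and> binary_word w"
  by (auto simp: binary_word_def)

lemma length_binary_word: "binary_word w \<Longrightarrow> length w = count_list w 0 + count_list w 1"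
  by (induction w) (auto simp: binary_word_Cons)

lemma count_list_replicate: "count_list (replicate m x) y = (if x = y then m else 0)"
  by (induction m) auto

lemma words_with_counts_0_left: "words_with_counts 0 q = {replicate q 1}"
proof -
  have "w = replicate q 1" if "w \<in> words_with_counts 0 q" for w
  proof -
    have "length w = q"
      using that length_binary_word[of w] by (simp add: words_with_counts_def)
    moreover have "\<forall>x\<in>set w. x = 1"
      using that by (auto simp: words_with_counts_def binary_word_def count_list_0_iff)
    ultimately show ?thesis
      using replicate_length_same[of w 1] by simp
  qed
  then show ?thesis
    by (auto simp: words_with_counts_def binary_word_def count_list_replicate)
qed

lemma words_with_counts_0_right: "words_with_counts p 0 = {replicate p 0}"
proof -
  have "w = replicate p 0" if "w \<in> words_with_counts p 0" for w
  proof -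
    have "length w = p"
      using that length_binary_word[of w] by (simp add: words_with_counts_def)
    moreover have "\<forall>x\<in>set w. x = 0"
      using that by (auto simp: words_with_counts_def binary_word_def count_list_0_iff)
    ultimately show ?thesis
      using replicate_length_same[of w 0] by simp
  qed
  then show ?thesis
    by (auto simp: words_with_counts_def binary_word_def count_list_replicate)
qed

lemma words_with_counts_Suc_Suc:
  "words_with_counts (Suc p) (Suc q) =
     Cons 0 ` words_with_counts p (Suc q) \<union> Cons 1 ` words_with_counts (Suc p) q"
proof (intro set_eqI)
  fix w
  show "w \<in> words_with_counts (Suc p) (Suc q) \<longleftrightarrow>
    w \<in> Cons 0 ` words_with_counts p (Suc q) \<union> Cons 1 ` words_with_counts (Suc p) q"
    by (cases w) (auto simp: words_with_counts_def binary_word_Cons)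
qed

lemma finite_words_with_counts: "finite (words_with_counts p q)"
proof (induction p arbitrary: q)
  case (Suc p)
  show ?case
    by (induction q) (simp_all add: words_with_counts_0_right words_with_counts_Suc_Suc Suc.IH)
qed (simp add: words_with_counts_0_left)

lemma card_words_with_counts: "card (words_with_counts p q) = (p + q) choose p"
proof (induction p arbitrary: q)
  case (Suc p)
  note fewer_zeros = Suc.IH
  show ?case
  proof (induction q)
    case (Suc q)
    have "card (words_with_counts (Suc p) (Suc q)) =
        card (Cons (0::nat) ` words_with_counts p (Suc q)) +
        card (Cons (1::nat) ` words_with_counts (Suc p) q)"
      unfolding words_with_counts_Suc_Suc
      by (rule card_Un_disjoint) (auto simp: finite_words_with_counts)
    also have "\<dots> = ((p + Suc q) choose p) + ((Suc p + q) choose Suc p)"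
      by (simp only: card_image inj_on_Cons1 fewer_zeros Suc.IH)
    finally show ?case by simp
  qed (simp add: words_with_counts_0_right)
qed (simp add: words_with_counts_0_left)

lemma even_binary_words_eq: "even_binary_words n = words_with_counts n n"
  using length_binary_word by (auto simp: even_binary_words_def words_with_counts_def)

section \<open>Equidistribution of the inversion number\<close>

definition residue_class :: "nat \<Rightarrow> nat \<Rightarrow> int \<Rightarrow> nat list set" where
  "residue_class p q k =
     {w \<in> words_with_counts p q. [int (num_inversions w) = k] (mod (int p + int q))}"

lemma card_residue_class_shift:
  "card (residue_class p q (k + int q)) = card (residue_class p q k)"
proof -
  have shift: "rotate1 w \<in> residue_class p q (k + int q) \<longleftrightarrow> w \<in> residue_class p q k" for w
  proof (cases "w \<in> words_with_counts p q")
    case True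
    have "[int (num_inversions (rotate1 w)) = k + int q] (mod (int p + int q)) \<longleftrightarrow>
        [int (num_inversions w) + int q = k + int q] (mod (int p + int q))"
      using num_inversions_rotate1[OF True] by (simp add: cong_def)
    also have "\<dots> \<longleftrightarrow> [int (num_inversions w) = k] (mod (int p + int q))"
      by (rule cong_add_rcancel)
    finally show ?thesis
      using True by (simp add: residue_class_def rotate1_in_words_with_counts_iff)
  qed (simp add: residue_class_def rotate1_in_words_with_counts_iff)
  have "residue_class p q (k + int q) = rotate1 ` residue_class p q k"
  proof
    show "residue_class p q (k + int q) \<subseteq> rotate1 ` residue_class p q k"
    proof
      fix v assume "v \<in> residue_class p q (k + int q)"
      moreover obtain w where "v = rotate1 w"
        using surj_rotate1 by (metis surjD)
      ultimately show "v \<in> rotate1 ` residue_class p q k"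
        using shift by blast
    qed
  qed (use shift in blast)
  moreover have "inj_on rotate1 (residue_class p q k)"
    using inj_rotate1 by (rule inj_on_subset) simp
  ultimately show ?thesis
    by (simp add: card_image)
qed

lemma card_residue_class_indep:
  assumes "coprime p q"
  shows "card (residue_class p q k) = card (residue_class p q k')"
proof -
  let ?M = "int p + int q"
  have multiple: "card (residue_class p q (k + int m * int q)) = card (residue_class p q k)" for m
  proof (induction m)
    case (Suc m)
    then show ?case
      using card_residue_class_shift[of p q "k + int m * int q"] by (simp add: algebra_simps)
  qed simp
  have "coprime q (p + q)"
    using assms by (metis coprime_iff_gcd_eq_1 gcd.commute gcd_add1)
  then have "coprime (int q) ?M"
    by (simp flip: of_nat_add)
  then obtain r where r: "[int q * r = 1] (mod ?M)"
    using cong_solve_coprime_int by blast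
  have "?M > 0"
    using assms by (cases "p = 0"; cases "q = 0") auto
  \<comment> \<open>The number of rotations that leads from \<open>k\<close> to \<open>k'\<close>.\<close>
  define m where "m = nat (((k' - k) * r) mod ?M)"
  have "[int m * int q = (k' - k) * r * int q] (mod ?M)"
    using \<open>?M > 0\<close> by (simp add: m_def cong_def mod_mult_left_eq)
  also have "[(k' - k) * r * int q = (k' - k) * 1] (mod ?M)"
    using cong_scalar_left[OF r, of "k' - k"] by (simp add: ac_simps)
  finally have "[k + int m * int q = k + (k' - k) * 1] (mod ?M)"
    by (simp only: cong_add_lcancel)
  then have "residue_class p q (k + int m * int q) = residue_class p q k'"
    by (simp add: residue_class_def cong_def)
  with multiple[of m] show ?thesis by simp
qed

lemma inversions_equidistributed:
  assumes "coprime p q"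
  shows "(p + q) * card (residue_class p q k) = (p + q) choose p"
proof -
  let ?M = "int p + int q"
  have "?M > 0"
    using assms by (cases "p = 0"; cases "q = 0") auto
  then have "words_with_counts p q = (\<Union>l\<in>{0..<?M}. residue_class p q l)"
    by (force simp: residue_class_def cong_def)
  then have "card (words_with_counts p q) = card (\<Union>l\<in>{0..<?M}. residue_class p q l)"
    by simp
  also have "\<dots> = (\<Sum>l\<in>{0..<?M}. card (residue_class p q l))"
    by (rule card_UN_disjoint)
       (auto simp: residue_class_def cong_def finite_words_with_counts)
  also have "\<dots> = (\<Sum>l\<in>{0..<?M}. card (residue_class p q k))"
    using card_residue_class_indep[OF assms] by (intro sum.cong) auto
  also have "\<dots> = (p + q) * card (residue_class p q k)"
    by (simp add: nat_add_distrib)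
  finally show ?thesis
    by (simp add: card_words_with_counts)
qed

section \<open>Even words\<close>

text \<open>
  A leading 0 adds no inversion and a leading 1 adds one for each of the \<open>n = Suc m\<close> zeros, so a
  residue class of even words is the union of one class of each kind of tail, the second of them
  at a shifted residue.
\<close>

lemma even_words_inv_cong_Suc:
  "even_words_inv_cong (Suc m) k =
     Cons 0 ` residue_class m (Suc m) k \<union>
     Cons 1 ` residue_class (Suc m) m (k - int (Suc m))"
proof -
  have shift: "[int c + a = k] (mod M) \<longleftrightarrow> [a = k - int c] (mod M)" for a M c
    by (simp add: cong_iff_dvd_diff algebra_simps)
  have modulus: "2 * int (Suc m) - 1 = int m + int (Suc m)"
    "int (Suc m) + int m = int m + int (Suc m)"
    by simp_all
  have count: "count_list w 0 = Suc m" if "w \<in> words_with_counts (Suc m) m" for w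
    using that by (simp add: words_with_counts_def)
  have zero: "0 # w \<in> even_words_inv_cong (Suc m) k \<longleftrightarrow> w \<in> residue_class m (Suc m) k" for w
    unfolding even_words_inv_cong_def even_binary_words_eq words_with_counts_Suc_Suc
      residue_class_def modulus
    by (auto simp: num_inversions_Cons)
  have one: "1 # w \<in> even_words_inv_cong (Suc m) k \<longleftrightarrow>
      w \<in> residue_class (Suc m) m (k - int (Suc m))" for w
    unfolding even_words_inv_cong_def even_binary_words_eq words_with_counts_Suc_Suc
      residue_class_def modulus
    using count shift[of "Suc m"] by (auto simp: num_inversions_Cons simp del: of_nat_Suc)
  have "\<exists>w. b = 0 # w \<or> b = 1 # w" if "b \<in> even_words_inv_cong (Suc m) k" for b
    using that
    unfolding even_words_inv_cong_def even_binary_words_eq words_with_counts_Suc_Suc by blast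
  then show ?thesis
    using zero one by blast
qed

lemma card_even_words_inv_cong:
  assumes "n \<ge> 1"
  shows "(2 * n - 1) * card (even_words_inv_cong n k) = (2 * n) choose n"
proof -
  obtain m where n: "n = Suc m"
    using assms by (cases n) auto
  let ?zero = "residue_class m (Suc m) k"
  let ?one = "residue_class (Suc m) m (k - int (Suc m))"
  have "card (even_words_inv_cong n k) = card (Cons 0 ` ?zero) + card (Cons 1 ` ?one)"
    unfolding n even_words_inv_cong_Suc
    by (rule card_Un_disjoint) (auto simp: residue_class_def finite_words_with_counts)
  also have "\<dots> = card ?zero + card ?one"
    by (simp add: card_image)
  finally have "(2 * n - 1) * card (even_words_inv_cong n k)
      = (m + Suc m) * card ?zero + (Suc m + m) * card ?one"
    by (simp add: n algebra_simps)
  also have "\<dots> = ((m + Suc m) choose m) + ((Suc m + m) choose Suc m)"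
    by (simp only: inversions_equidistributed coprime_Suc_left_nat coprime_Suc_right_nat)
  also have "\<dots> = (2 * n) choose n"
    by (simp add: n mult_2)
  finally show ?thesis .
qed

theorem theorem2:
  fixes n :: nat
  assumes "n \<ge> 1"
  shows "(\<forall>k k' :: int. card (even_words_inv_cong n k) = card (even_words_inv_cong n k')) \<and>
         (\<forall>k :: int. real (card (even_words_inv_cong n k)) =
            1 / (2 * real n - 1) * real ((2 * n) choose n))"
proof -
  have "real (card (even_words_inv_cong n k)) =
      1 / (2 * real n - 1) * real ((2 * n) choose n)" for k
  proof -
    have "real (2 * n - 1) = 2 * real n - 1"
      using assms by (simp add: of_nat_diff)
    moreover have "real (2 * n - 1) * real (card (even_words_inv_cong n k)) = real ((2 * n) choose n)"
      using card_even_words_inv_cong[OF assms, of k] by (metis of_nat_mult)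
    moreover have "2 * real n - 1 \<noteq> 0"
      using assms by linarith
    ultimately show ?thesis
      by (simp add: field_simps)
  qed
  then show ?thesis
    by (metis of_nat_eq_iff)
qed

end
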